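(* Let $q\in\{3,4\}$. There is $d_0$ such that for every integer $d\ge d_0$, the complete $q$-ary tree $T$ of depth $d$ satisfies \[\Phi_V(T)\le d-\lfloor\log_q(d)\rfloor+2\le d-\log_q(d)+3.\]
   Context: The complete $q$-ary tree of depth $d$ is the rooted tree in which every vertex at distance less than $d$ from the root has exactly $q$ children, and the vertices at distance $d$ from the root are leaves. For a graph $G$ and $S\subseteq V(G)$, $\delta(S)=\{v\in V(G)\setminus S : N(v)\cap S\neq\emptyset\}$; $\Phi_V(G,s)=\min_{|S|=s}|\delta(S)|$ and $\Phi_V(G)=\max_{0\le s\le |V(G)|}\Phi_V(G,s)$. *)

theory Defs
  imports Complex_Main "HOL-Library.Sublist"
    "Graph_Theory.Pair_Digraph" "Graph_Theory.Vertex_Walk"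
begin

text \<open>
  Finite simple graphs are those of the locale \<^locale>\<open>pair_graph\<close>: an undirected edge
  between \<open>u\<close> and \<open>v\<close> is the pair of opposite arcs \<open>(u, v)\<close>, \<open>(v, u)\<close>.
\<close>

definition nbhd :: "'a pair_pre_digraph \<Rightarrow> 'a \<Rightarrow> 'a set" where
  "nbhd G v = {u. (v, u) \<in> parcs G}"

definition vertex_boundary :: "'a pair_pre_digraph \<Rightarrow> 'a set \<Rightarrow> 'a set" where
  "vertex_boundary G S = {v \<in> pverts G - S. nbhd G v \<inter> S \<noteq> {}}"

text \<open>
  Both extrema below are over finite sets when \<open>pverts G\<close> is finite, and are nonempty when
  moreover \<open>s \<le> card (pverts G)\<close>; otherwise the values are unspecified.
\<close>

definition Phi_V_at :: "'a pair_pre_digraph \<Rightarrow> nat \<Rightarrow> nat" where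
  "Phi_V_at G s = Min {card (vertex_boundary G S) |S. S \<subseteq> pverts G \<and> card S = s}"

definition Phi_V :: "'a pair_pre_digraph \<Rightarrow> nat" where
  "Phi_V G = Max {Phi_V_at G s |s. 0 \<le> s \<and> s \<le> card (pverts G)}"

text \<open>
  A vertex of the complete \<open>q\<close>-ary tree is encoded by its address: the list of branch choices
  (numbers below \<open>q\<close>) on the way from the root \<open>[]\<close>. The distance from the root is the length
  of the list, and the children of \<open>xs\<close> are the lists \<open>xs @ [i]\<close>.
\<close>

definition complete_tree :: "nat \<Rightarrow> nat \<Rightarrow> nat list pair_pre_digraph" where
  "complete_tree q d =
     (let V = {xs. set xs \<subseteq> {..<q} \<and> length xs \<le> d}
      in \<lparr> pverts = V,
           parcs = {(xs, ys) \<in> V \<times> V. (\<exists>i. ys = xs @ [i]) \<or> (\<exists>i. xs = ys @ [i])} \<rparr>)"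

text \<open>
  The remaining facts confirm that this is the intended rooted tree: a finite simple graph in
  which every vertex is joined to the root by a unique path, vertices at distance less than
  \<open>d\<close> have exactly \<open>q\<close> children, and those at distance \<open>d\<close> have none.
\<close>

lemma pverts_complete_tree:
  "pverts (complete_tree q d) = {xs. set xs \<subseteq> {..<q} \<and> length xs \<le> d}"
  by (simp add: complete_tree_def)

lemma parcs_complete_tree:
  "(xs, ys) \<in> parcs (complete_tree q d) \<longleftrightarrow>
     xs \<in> pverts (complete_tree q d) \<and> ys \<in> pverts (complete_tree q d) \<and>
     ((\<exists>i. ys = xs @ [i]) \<or> (\<exists>i. xs = ys @ [i]))"
  by (auto simp: complete_tree_def)

lemma pair_graph_complete_tree: "pair_graph (complete_tree q d)"
proof
  have V: "finite (pverts (complete_tree q d))"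
    unfolding pverts_complete_tree by (rule finite_lists_length_le) simp
  then show "finite (pverts (complete_tree q d))" .
  have "parcs (complete_tree q d) \<subseteq> pverts (complete_tree q d) \<times> pverts (complete_tree q d)"
    using parcs_complete_tree by auto
  with V show "finite (parcs (complete_tree q d))"
    by (meson finite_SigmaI finite_subset)
  show "symmetric (with_proj (complete_tree q d))"
    by (auto simp: symmetric_def sym_def parcs_complete_tree)
qed (auto simp: parcs_complete_tree)

lemma complete_tree_unique_root_path:
  assumes "v \<in> pverts (complete_tree q d)"
  shows "vpath p (with_proj (complete_tree q d)) \<and> hd p = [] \<and> last p = v \<longleftrightarrow> p = prefixes v"
proof
  assume "vpath p (with_proj (complete_tree q d)) \<and> hd p = [] \<and> last p = v"
  then have "distinct p" "set (vwalk_arcs p) \<subseteq> parcs (complete_tree q d)"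
    "p \<noteq> []" "hd p = []" "last p = v"
    by (auto simp: vpath_def vwalk_def)
  then show "p = prefixes v"
  proof (induction p arbitrary: v rule: rev_induct)
    case (snoc b p)
    show ?case
    proof (cases "p = []")
      case True
      with snoc.prems show ?thesis by simp
    next
      case False
      have arcs: "vwalk_arcs (p @ [b]) = vwalk_arcs p @ [(last p, b)]"
        using vwalk_arcs_append[OF False, of "[b]"] by simp
      have p: "p = prefixes (last p)"
      proof (rule snoc.IH)
        show "hd p = []" using snoc.prems(4) False by simp
      qed (use snoc.prems arcs False in auto)
      have "(last p, b) \<in> parcs (complete_tree q d)"
        using snoc.prems(2) arcs by simp
      then consider i where "b = last p @ [i]" | i where "last p = b @ [i]"
        by (auto simp: parcs_complete_tree)
      then show ?thesis
      proof cases
        case 1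
        have "prefixes (last p @ [i]) = p @ [last p @ [i]]"
          by (simp only: prefixes_snoc p[symmetric])
        moreover have "v = b" using snoc.prems(5) by simp
        ultimately show ?thesis by (simp only: 1)
      next
        case 2
        then have "b \<in> set (prefixes (last p))" by simp
        then have "b \<in> set p" by (simp only: p[symmetric])
        then show ?thesis using snoc.prems(1) by simp
      qed
    qed
  qed simp
next
  have "vpath (prefixes v) (with_proj (complete_tree q d)) \<and> last (prefixes v) = v"
    using assms
  proof (induction v rule: rev_induct)
    case (snoc i v)
    then have v: "v \<in> pverts (complete_tree q d)"
      by (simp add: pverts_complete_tree)
    with snoc show ?case
      by (auto simp: vpath_def vwalk_def vwalk_arcs_append parcs_complete_tree)
  qed (auto simp: vpath_def vwalk_def)
  moreover have "hd (prefixes v) = []" by (cases v) auto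
  ultimately show "p = prefixes v \<Longrightarrow>
      vpath p (with_proj (complete_tree q d)) \<and> hd p = [] \<and> last p = v"
    by simp
qed

lemma card_children_complete_tree:
  assumes "xs \<in> pverts (complete_tree q d)"
  shows "card {ys \<in> nbhd (complete_tree q d) xs. length ys = Suc (length xs)} =
    (if length xs < d then q else 0)"
proof -
  have "ys \<in> nbhd (complete_tree q d) xs \<and> length ys = Suc (length xs) \<longleftrightarrow>
      (\<exists>i<q. ys = xs @ [i]) \<and> length xs < d" for ys
  proof
    assume ys: "ys \<in> nbhd (complete_tree q d) xs \<and> length ys = Suc (length xs)"
    then obtain i where i: "ys = xs @ [i]"
      unfolding nbhd_def parcs_complete_tree by fastforce
    from ys have "ys \<in> pverts (complete_tree q d)"
      unfolding nbhd_def parcs_complete_tree by simp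
    with i show "(\<exists>i<q. ys = xs @ [i]) \<and> length xs < d"
      by (simp add: pverts_complete_tree)
  next
    assume "(\<exists>i<q. ys = xs @ [i]) \<and> length xs < d"
    then obtain i where "i < q" "ys = xs @ [i]" "length xs < d" by blast
    with assms show "ys \<in> nbhd (complete_tree q d) xs \<and> length ys = Suc (length xs)"
      by (simp add: nbhd_def parcs_complete_tree pverts_complete_tree)
  qed
  then have "{ys \<in> nbhd (complete_tree q d) xs. length ys = Suc (length xs)} =
      (if length xs < d then (\<lambda>i. xs @ [i]) ` {..<q} else {})"
    by (simp only:) auto
  then show ?thesis
    by (simp only:) (simp add: card_image inj_on_def)
qed

end

theory Submission
  imports Defs
begin

text \<open>
  Descend from the root along a path, filling at each path vertex as many whole subtrees hanging
  off the path as fit into \<open>s\<close>; the path vertices form the boundary. Filling down to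
  the bottom costs one boundary vertex per nonzero digit of this greedy expansion. Stopping
  instead at height \<open>m = \<lfloor>log\<^sub>q d\<rfloor> - 1\<close> leaves a remainder below the size of a subtree of
  height \<open>m\<close>, which is at most \<open>d / 2\<close>. That remainder is absorbed one unit at a time without
  enlarging the boundary: a path vertex whose digit is at least \<open>q - 2\<close> may be added to the set,
  since then at most one new child enters the boundary in its place; and where the digit is \<open>1\<close>
  (after rounding up instead of down) the root of the filled subtree may be dropped, since it
  replaces its parent in the boundary. For \<open>q \<le> 4\<close> every nonzero digit is of one of these two
  kinds, so either enough corrections in one direction are available, or there are many zero
  digits and the full greedy expansion is cheap.
\<close>

section \<open>Trees assembled from the subtrees below the root\<close>

abbreviation verts :: "nat \<Rightarrow> nat \<Rightarrow> nat list set" where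
  "verts q h \<equiv> pverts (complete_tree q h)"

lemma finite_verts: "finite (verts q h)"
  unfolding pverts_complete_tree by (rule finite_lists_length_le) simp

lemma Nil_in_verts: "[] \<in> verts q h"
  by (simp add: pverts_complete_tree)

lemma card_verts_pos: "card (verts q h) > 0"
  using Nil_in_verts finite_verts card_gt_0_iff by blast

text \<open>Prefixing \<open>i\<close> to addresses places a set in the subtree of the
  \<open>i\<close>-th child, and \<open>a\<close> decides on the new root. This allows induction on
  the height, with the path growing upwards.\<close>

definition join :: "nat \<Rightarrow> bool \<Rightarrow> (nat \<Rightarrow> nat list set) \<Rightarrow> nat list set" where
  "join q a F = (if a then {[]} else {}) \<union> (\<Union>i<q. Cons i ` F i)"

lemma Nil_in_join [simp]: "[] \<in> join q a F \<longleftrightarrow> a"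
  by (auto simp: join_def)

lemma Cons_in_join [simp]: "i # x \<in> join q a F \<longleftrightarrow> i < q \<and> x \<in> F i"
  by (auto simp: join_def)

lemma card_join:
  assumes "\<And>i. i < q \<Longrightarrow> finite (F i)"
  shows "card (join q a F) = of_bool a + (\<Sum>i<q. card (F i))"
proof -
  have "card (\<Union>i<q. Cons i ` F i) = (\<Sum>i<q. card (Cons i ` F i))"
    using assms by (intro card_UN_disjoint) auto
  also have "\<dots> = (\<Sum>i<q. card (F i))"
    by (simp add: card_image)
  finally have *: "card (\<Union>i<q. Cons i ` F i) = (\<Sum>i<q. card (F i))" .
  have "[] \<notin> (\<Union>i<q. Cons i ` F i)" "finite (\<Union>i<q. Cons i ` F i)"
    using assms by auto
  with * show ?thesis by (simp add: join_def)
qed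

lemma join_mono:
  assumes "a \<Longrightarrow> b" "\<And>i. i < q \<Longrightarrow> F i \<subseteq> G i"
  shows "join q a F \<subseteq> join q b G"
  unfolding join_def using assms by (intro Un_mono UN_mono image_mono) auto

lemma verts_Suc: "verts q (Suc h) = join q True (\<lambda>_. verts q h)"
proof (rule set_eqI)
  show "x \<in> verts q (Suc h) \<longleftrightarrow> x \<in> join q True (\<lambda>_. verts q h)" for x
    by (cases x) (auto simp: pverts_complete_tree)
qed

lemma card_verts_0 [simp]: "card (verts q 0) = 1"
proof -
  have "verts q 0 = {[]}" by (auto simp: pverts_complete_tree)
  then show ?thesis by simp
qed

lemma card_verts_Suc: "card (verts q (Suc h)) = q * card (verts q h) + 1"
  by (simp add: verts_Suc card_join finite_verts)

section \<open>Sets enclosed by a boundary\<close>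

text \<open>\<open>B\<close> only has to contain the boundary of \<open>S\<close>. The slack allows
  \<open>S = {}\<close> with \<open>B = {[]}\<close>, a root reserved as boundary before its parent
  joins the set.\<close>

definition separates :: "nat \<Rightarrow> nat \<Rightarrow> nat list set \<Rightarrow> nat list set \<Rightarrow> bool" where
  "separates q h S B \<longleftrightarrow> S \<subseteq> verts q h \<and> B \<subseteq> verts q h \<and>
     (\<forall>x i. x @ [i] \<in> verts q h \<longrightarrow>
        (x \<in> S \<longrightarrow> x @ [i] \<in> S \<union> B) \<and> (x @ [i] \<in> S \<longrightarrow> x \<in> S \<union> B))"

lemma separates_finite: "separates q h S B \<Longrightarrow> finite S \<and> finite B"
  unfolding separates_def using finite_verts finite_subset by blast

lemma separates_vertex_boundary:
  assumes "separates q h S B"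
  shows "vertex_boundary (complete_tree q h) S \<subseteq> B"
  using assms unfolding separates_def vertex_boundary_def nbhd_def parcs_complete_tree by blast

lemma separates_empty: "separates q h {} {}"
  and separates_empty_root: "separates q h {} {[]}"
  and separates_verts: "separates q h (verts q h) {}"
  by (auto simp: separates_def Nil_in_verts) (simp add: pverts_complete_tree)

lemma separates_verts_minus_root: "separates q h (verts q h - {[]}) {[]}"
  by (auto simp: separates_def Nil_in_verts) (simp add: pverts_complete_tree)

text \<open>The last two assumptions treat the edges between the new root and its children; every
  other edge lies inside one subtree.\<close>

lemma separates_join:
  assumes "\<And>i. i < q \<Longrightarrow> separates q h (F i) (G i)"
    and "\<And>i. a \<Longrightarrow> i < q \<Longrightarrow> [] \<in> F i \<union> G i"
    and "\<And>i. i < q \<Longrightarrow> [] \<in> F i \<Longrightarrow> a \<or> b"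
  shows "separates q (Suc h) (join q a F) (join q b G)"
  unfolding separates_def
proof (intro conjI allI impI)
  have "F i \<subseteq> verts q h" "G i \<subseteq> verts q h" if "i < q" for i
    using assms(1)[OF that] unfolding separates_def by blast+
  then show "join q a F \<subseteq> verts q (Suc h)" "join q b G \<subseteq> verts q (Suc h)"
    unfolding verts_Suc by (intro join_mono; simp)+
next
  fix x i
  assume x: "x @ [i] \<in> verts q (Suc h)" "x \<in> join q a F"
  show "x @ [i] \<in> join q a F \<union> join q b G"
  proof (cases x)
    case Nil
    then show ?thesis using x assms(2)[of i] by (auto simp: verts_Suc)
  next
    case (Cons k y)
    with x have y: "k < q" "y @ [i] \<in> verts q h" "y \<in> F k"
      by (simp_all add: verts_Suc)
    then have "y @ [i] \<in> F k \<union> G k"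
      using assms(1)[OF y(1)] unfolding separates_def by blast
    with y(1) Cons show ?thesis by simp
  qed
next
  fix x i
  assume x: "x @ [i] \<in> verts q (Suc h)" "x @ [i] \<in> join q a F"
  show "x \<in> join q a F \<union> join q b G"
  proof (cases x)
    case Nil
    then show ?thesis using x assms(3)[of i] by auto
  next
    case (Cons k y)
    with x have y: "k < q" "y @ [i] \<in> verts q h" "y @ [i] \<in> F k"
      by (simp_all add: verts_Suc)
    then have "y \<in> F k \<union> G k"
      using assms(1)[OF y(1)] unfolding separates_def by blast
    with y(1) Cons show ?thesis by simp
  qed
qed

section \<open>Extending a set by one level\<close>

text \<open>The two root conditions say what a parent may do: here it may join the set without
  affecting this child, while under \<open>sep_out\<close> it may stay outside the boundary as well.
  A root in \<open>B - S\<close> satisfies both.\<close>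

definition sep_in :: "nat \<Rightarrow> nat \<Rightarrow> nat \<Rightarrow> nat \<Rightarrow> bool" where
  "sep_in q h s b \<longleftrightarrow> (\<exists>S B. separates q h S B \<and> card S = s \<and> card B \<le> b \<and> [] \<in> S \<union> B)"

definition sep_out :: "nat \<Rightarrow> nat \<Rightarrow> nat \<Rightarrow> nat \<Rightarrow> bool" where
  "sep_out q h s b \<longleftrightarrow> (\<exists>S B. separates q h S B \<and> card S = s \<and> card B \<le> b \<and> [] \<notin> S)"

lemma sum_first_children:
  fixes f :: "nat \<Rightarrow> nat"
  assumes "c < q" and f: "\<And>i. 0 < i \<Longrightarrow> f i = (if i \<le> c then y else 0)"
  shows "(\<Sum>i<q. f i) = f 0 + c * y"
proof -
  have "(\<Sum>i<q. f i) = (\<Sum>i\<in>{0..c}. f i)"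
    using assms by (intro sum.mono_neutral_right) auto
  also have "\<dots> = f 0 + (\<Sum>i\<in>{0<..c}. f i)"
    by (rule sum.head) simp
  also have "(\<Sum>i\<in>{0<..c}. f i) = (\<Sum>i\<in>{0<..c}. y)"
    using f by (intro sum.cong) auto
  finally show ?thesis by simp
qed

text \<open>The new root is put into the boundary, which shields the children from each other, so
  nothing is required of the old root and both root conditions hold afterwards.\<close>

lemma sep_fill:
  assumes "sep_in q h s b \<or> sep_out q h s b" "c < q"
  shows "sep_in q (Suc h) (s + c * card (verts q h)) (Suc b)"
    and "sep_out q (Suc h) (s + c * card (verts q h)) (Suc b)"
proof -
  obtain S B where SB: "separates q h S B" "card S = s" "card B \<le> b"
    using assms(1) unfolding sep_in_def sep_out_def by blast
  define F where "F i = (if i = 0 then S else if i \<le> c then verts q h else {})" for i :: nat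
  define G where "G i = (if i = 0 then B else {})" for i :: nat
  have "separates q (Suc h) (join q False F) (join q True G)"
    by (rule separates_join) (auto simp: F_def G_def SB separates_empty separates_verts)
  moreover have "card (join q False F) = s + c * card (verts q h)"
    using separates_finite[OF SB(1)]
    by (simp add: card_join F_def finite_verts SB
        sum_first_children[OF assms(2), where y = "card (verts q h)"])
  moreover have "card (join q True G) \<le> Suc b"
    using separates_finite[OF SB(1)] assms(2)
    by (simp add: card_join G_def SB sum_first_children[where c = 0 and y = 0])
  ultimately show "sep_in q (Suc h) (s + c * card (verts q h)) (Suc b)"
    "sep_out q (Suc h) (s + c * card (verts q h)) (Suc b)"
    unfolding sep_in_def sep_out_def by (metis Nil_in_join UnCI)+
qed

text \<open>This gains one unit over \<open>sep_fill\<close> at the same cost: the new root joins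
  the set, and at most one child, empty so far, takes its place in the boundary.\<close>

lemma sep_fill_root:
  assumes "sep_in q h s b" "c < q" "q \<le> c + 2"
  shows "sep_in q (Suc h) (s + c * card (verts q h) + 1) (Suc b)"
proof -
  obtain S B where SB: "separates q h S B" "card S = s" "card B \<le> b" "[] \<in> S \<union> B"
    using assms(1) unfolding sep_in_def by blast
  define F where "F i = (if i = 0 then S else if i \<le> c then verts q h else {})" for i :: nat
  define G where "G i = (if i = 0 then B else if i \<le> c then {} else {[]})" for i :: nat
  have "separates q (Suc h) (join q True F) (join q False G)"
    using SB(4) by (intro separates_join)
      (auto simp: F_def G_def SB separates_empty separates_empty_root separates_verts Nil_in_verts)
  moreover have "card (join q True F) = s + c * card (verts q h) + 1"
    using separates_finite[OF SB(1)]
    by (simp add: card_join F_def finite_verts SB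
        sum_first_children[OF assms(2), where y = "card (verts q h)"])
  moreover have "card (join q False G) \<le> Suc b"
  proof -
    have "card (join q False G) = (\<Sum>i<q. card (G i))"
      using separates_finite[OF SB(1)] by (subst card_join) (auto simp: G_def)
    \<comment> \<open>By \<open>q \<le> c + 2\<close>, the only child beyond \<open>c\<close> can be
      \<open>Suc c\<close>.\<close>
    also have "\<dots> \<le> (\<Sum>i<q. (if i = 0 then card B else 0) + (if i = Suc c then 1 else 0))"
      using assms(3) by (intro sum_mono) (auto simp: G_def)
    also have "\<dots> \<le> Suc b"
      using SB(3) by (simp add: sum.distrib)
    finally show ?thesis .
  qed
  ultimately show ?thesis
    unfolding sep_in_def by (metis Nil_in_join UnCI)
qed

text \<open>This loses one unit against \<open>sep_fill\<close> with \<open>c = 1\<close> at the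
  same cost: the root of the filled subtree becomes boundary, and the new root then has no neighbour
  in the set.\<close>

lemma sep_drop_root:
  assumes "sep_out q h s b" "1 < q"
  shows "sep_out q (Suc h) (s + (card (verts q h) - 1)) (Suc b)"
proof -
  obtain S B where SB: "separates q h S B" "card S = s" "card B \<le> b" "[] \<notin> S"
    using assms(1) unfolding sep_out_def by blast
  define F where "F i = (if i = 0 then S else if i \<le> 1 then verts q h - {[]} else {})" for i :: nat
  define G where "G i = (if i = 0 then B else if i \<le> 1 then {[]} else {})" for i :: nat
  have "separates q (Suc h) (join q False F) (join q False G)"
    using SB(4) by (intro separates_join)
      (auto simp: F_def G_def SB separates_empty separates_verts_minus_root split: if_splits)
  moreover have "card (join q False F) = s + (card (verts q h) - 1)"
    using separates_finite[OF SB(1)]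
    by (simp add: card_join F_def finite_verts SB Nil_in_verts
        sum_first_children[OF assms(2), where y = "card (verts q h) - 1"])
  moreover have "card (join q False G) \<le> Suc b"
    using separates_finite[OF SB(1)] SB(3)
    by (simp add: card_join G_def sum_first_children[OF assms(2), where y = 1])
  ultimately show ?thesis
    unfolding sep_out_def by (metis Nil_in_join)
qed

text \<open>A zero digit is free: with the old root outside \<open>S\<close>, the new root has no
  neighbour in the set.\<close>

lemma sep_lift:
  assumes "sep_out q h s b" "0 < q"
  shows "sep_out q (Suc h) s b"
proof -
  obtain S B where SB: "separates q h S B" "card S = s" "card B \<le> b" "[] \<notin> S"
    using assms(1) unfolding sep_out_def by blast
  define F where "F i = (if i = 0 then S else {})" for i :: nat
  define G where "G i = (if i = 0 then B else {})" for i :: nat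
  have "separates q (Suc h) (join q False F) (join q False G)"
    using SB(4) by (intro separates_join) (auto simp: F_def G_def SB separates_empty split: if_splits)
  moreover have "card (join q False F) = s" "card (join q False G) \<le> b"
    using separates_finite[OF SB(1)] SB(3)
    by (simp_all add: card_join F_def G_def SB sum_first_children[OF assms(2), where y = 0])
  ultimately show ?thesis
    unfolding sep_out_def by (metis Nil_in_join)
qed

lemma sep_out_verts_minus_root: "sep_out q h (card (verts q h) - 1) 1"
  unfolding sep_out_def
  using separates_verts_minus_root[of q h] finite_verts[of q h] Nil_in_verts[of q h]
  by (intro exI[of _ "verts q h - {[]}"] exI[of _ "{[]}"]) auto

lemma sep_out_mono: "sep_out q h s b \<Longrightarrow> b \<le> b' \<Longrightarrow> sep_out q h s b'"
  unfolding sep_out_def using order_trans by blast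

section \<open>Greedy expansion and its corrections\<close>

text \<open>
  The digit \<open>q\<close> can occur only once in the expansion, when nothing remains.
\<close>

lemma digit_cases:
  assumes "s < card (verts q (Suc h))"
  obtains (full) "s = card (verts q (Suc h)) - 1"
    | (digit) c s' where "c < q" "s' < card (verts q h)" "s = s' + c * card (verts q h)"
\<comment> \<open>The assumption gives \<open>s \<le> q * card (verts q h)\<close>, so the quotient
  reaches \<open>q\<close> only in case of equality.\<close>
proof (cases "s = q * card (verts q h)")
  case True
  then show thesis using full by (simp add: card_verts_Suc)
next
  case False
  then have "s div card (verts q h) < q"
    using assms card_verts_pos[of q h] by (simp add: card_verts_Suc div_less_iff_less_mult)
  then show thesis
    using digit[of "s div card (verts q h)" "s mod card (verts q h)"] card_verts_pos[of q h]
    by simp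
qed

text \<open>One boundary vertex per level suffices; each zero digit will later save one from this
  cost.\<close>

lemma sep_out_greedy:
  "s < card (verts q h) \<Longrightarrow> sep_out q h s h"
proof (induction h arbitrary: s)
  case 0
  then have "s = 0" by simp
  then show ?case
    unfolding sep_out_def using separates_empty[of q 0] by force
next
  case (Suc h)
  from Suc.prems show ?case
  proof (cases rule: digit_cases)
    case full
    then show ?thesis using sep_out_mono[OF sep_out_verts_minus_root, of "Suc h"] by simp
  next
    case (digit c s')
    then show ?thesis using sep_fill(2)[of q h s' h c] Suc.IH[of s'] by simp
  qed
qed

text \<open>
  \<open>P\<close>, \<open>M\<close> and \<open>z\<close> count the digits above height \<open>m\<close> that are at least \<open>q - 2\<close>, equal to \<open>1\<close>,
  and equal to \<open>0\<close>, each digit once; \<open>D\<close> is the sum of the digits above height \<open>m\<close> with their weights.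
\<close>

definition corrections :: "nat \<Rightarrow> nat \<Rightarrow> nat \<Rightarrow> nat \<Rightarrow> nat \<Rightarrow> nat \<Rightarrow> nat \<Rightarrow> nat \<Rightarrow> nat \<Rightarrow> bool" where
  "corrections q m h s D r P M z \<longleftrightarrow>
     s = D + r \<and> r < card (verts q m) \<and> h \<le> m + P + M + z \<and> m + z \<le> h \<and>
     (\<forall>j\<le>P. sep_in q h (D + j) (h - m + 1)) \<and>
     (\<forall>j\<le>M. \<exists>y. y + j + 1 = D + card (verts q m) \<and> sep_out q h y (h - m + 1)) \<and>
     sep_out q h s (h - z)"

lemma corrections_step:
  assumes "corrections q m h s D r P M z" "c < q" "3 \<le> q" "q \<le> 4"
  shows "\<exists>D P M z. corrections q m (Suc h) (s + c * card (verts q h)) D r P M z"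
proof -
  let ?t = "card (verts q h)"
  have a: "s = D + r" "r < card (verts q m)" "h \<le> m + P + M + z" "m + z \<le> h"
    "\<And>j. j \<le> P \<Longrightarrow> sep_in q h (D + j) (h - m + 1)"
    "\<And>j. j \<le> M \<Longrightarrow> \<exists>y. y + j + 1 = D + card (verts q m) \<and> sep_out q h y (h - m + 1)"
    "sep_out q h s (h - z)"
    using assms(1) unfolding corrections_def by auto
  have h: "Suc h - m + 1 = Suc (h - m + 1)" "Suc h - z = Suc (h - z)" using a(4) by auto
  have inn: "sep_in q (Suc h) (D + c * ?t + j) (Suc h - m + 1)" if "j \<le> P" for j
    using sep_fill(1)[OF disjI1[OF a(5)[OF that]] assms(2)] h by (simp add: ac_simps)
  have out: "\<exists>y. y + j + 1 = D + c * ?t + card (verts q m) \<and> sep_out q (Suc h) y (Suc h - m + 1)"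
    if j: "j \<le> M" for j
  proof -
    obtain y where y: "y + j + 1 = D + card (verts q m)" "sep_out q h y (h - m + 1)"
      using a(6)[OF j] by blast
    then show ?thesis
      using sep_fill(2)[OF disjI2[OF y(2)] assms(2)] h
      by (intro exI[of _ "y + c * ?t"]) simp
  qed
  have all: "sep_out q (Suc h) (s + c * ?t) (Suc h - z)"
    using sep_fill(2)[OF disjI2[OF a(7)] assms(2)] h by simp
  \<comment> \<open>This is where \<open>q \<le> 4\<close> enters: a digit \<open>c \<ge> 2\<close>
    satisfies \<open>q \<le> c + 2\<close>.\<close>
  consider "c = 0" | "c = 1" | "q \<le> c + 2" using assms by linarith
  then show ?thesis
  proof cases
    case 1
    have "sep_out q (Suc h) s (Suc h - Suc z)"
      using sep_lift[OF a(7)] assms(3) by simp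
    then have "corrections q m (Suc h) (s + c * ?t) (D + c * ?t) r P M (Suc z)"
      unfolding corrections_def using a(1-4) inn out 1 by auto
    then show ?thesis by blast
  next
    case 2
    have "\<exists>y. y + j + 1 = D + c * ?t + card (verts q m) \<and> sep_out q (Suc h) y (Suc h - m + 1)"
      if "j \<le> Suc M" for j
    proof (cases j)
      case 0
      then show ?thesis using out[of 0] by simp
    next
      case (Suc i)
      then obtain y where y: "y + i + 1 = D + card (verts q m)" "sep_out q h y (h - m + 1)"
        using a(6)[of i] \<open>j \<le> Suc M\<close> by auto
      have "sep_out q (Suc h) (y + (?t - 1)) (Suc h - m + 1)"
        using sep_drop_root[OF y(2)] assms(3) h by simp
      moreover have "y + (?t - 1) + j + 1 = D + c * ?t + card (verts q m)"
        using y(1) 2 Suc card_verts_pos[of q h] by simp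
      ultimately show ?thesis by blast
    qed
    then have "corrections q m (Suc h) (s + c * ?t) (D + c * ?t) r P (Suc M) z"
      unfolding corrections_def using a(1-4) inn all by auto
    then show ?thesis by blast
  next
    case 3
    have "sep_in q (Suc h) (D + c * ?t + j) (Suc h - m + 1)" if "j \<le> Suc P" for j
    proof (cases j)
      case 0
      then show ?thesis using inn[of 0] by simp
    next
      case (Suc i)
      then show ?thesis
        using sep_fill_root[OF a(5)[of i] assms(2) 3] that h by (simp add: ac_simps)
    qed
    then have "corrections q m (Suc h) (s + c * ?t) (D + c * ?t) r (Suc P) M z"
      unfolding corrections_def using a(1-4) out all by auto
    then show ?thesis by blast
  qed
qed

text \<open>The first alternative covers an expansion containing the digit \<open>q\<close>: one
  boundary vertex settles it there, and each higher level adds at most one.\<close>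

lemma corrections_exist:
  assumes "m \<le> h" "s < card (verts q h)" "3 \<le> q" "q \<le> 4"
  shows "sep_out q h s (h - m + 1) \<or> (\<exists>D r P M z. corrections q m h s D r P M z)"
  using assms(1,2)
proof (induction h arbitrary: s rule: dec_induct)
  case base
  \<comment> \<open>Rounding down leaves the subtree of height \<open>m\<close> empty, with its root
    as boundary.\<close>
  have "sep_in q m 0 1"
    unfolding sep_in_def using separates_empty_root[of q m]
    by (intro exI[of _ "{}"] exI[of _ "{[]}"]) simp
  \<comment> \<open>Rounding up fills that subtree except for its root, hence the offset
    \<open>1\<close> in \<open>corrections\<close>.\<close>
  moreover have "\<exists>y. y + 1 = card (verts q m) \<and> sep_out q m y 1"
    using sep_out_verts_minus_root[of q m] card_verts_pos[of q m]
    by (intro exI[of _ "card (verts q m) - 1"]) simp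
  ultimately have "corrections q m m s 0 s 0 0 0"
    unfolding corrections_def using base sep_out_greedy by simp
  then show ?case by blast
next
  case (step h)
  from step.prems show ?case
  proof (cases rule: digit_cases)
    case full
    then show ?thesis using sep_out_mono[OF sep_out_verts_minus_root] by simp
  next
    case (digit c s')
    from step.IH[OF digit(2)] show ?thesis
    proof
      assume "sep_out q h s' (h - m + 1)"
      then show ?thesis
        using sep_fill(2)[of q h s' "h - m + 1" c] digit step.hyps by (simp add: Suc_diff_le)
    next
      assume "\<exists>D r P M z. corrections q m h s' D r P M z"
      then show ?thesis using corrections_step digit assms by metis
    qed
  qed
qed

section \<open>From small boundaries to the bound on \<open>Phi_V\<close>\<close>

lemma small_boundary_exists:
  assumes "card (verts q m) + 2 * m \<le> d" "3 \<le> q" "q \<le> 4" "s \<le> card (verts q d)"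
  shows "\<exists>S \<subseteq> verts q d. card S = s \<and> card (vertex_boundary (complete_tree q d) S) \<le> d - m + 1"
proof -
  have "\<exists>S B. separates q d S B \<and> card S = s \<and> card B \<le> d - m + 1"
  proof (cases "s = card (verts q d)")
    case True
    then have "separates q d (verts q d) {} \<and> card (verts q d) = s \<and>
        card ({} :: nat list set) \<le> d - m + 1"
      using separates_verts by simp
    then show ?thesis by (intro exI)
  next
    case False
    then have s: "s < card (verts q d)" using assms(4) by simp
    have "m \<le> d" using assms(1) by simp
    from corrections_exist[OF this s assms(2,3)]
    have "sep_in q d s (d - m + 1) \<or> sep_out q d s (d - m + 1)"
    proof (elim disjE exE)
      fix D r P M z
      assume "corrections q m d s D r P M z"
      then have a: "s = D + r" "r < card (verts q m)" "d \<le> m + P + M + z"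
        "\<And>j. j \<le> P \<Longrightarrow> sep_in q d (D + j) (d - m + 1)"
        "\<And>j. j \<le> M \<Longrightarrow> \<exists>y. y + j + 1 = D + card (verts q m) \<and> sep_out q d y (d - m + 1)"
        "sep_out q d s (d - z)"
        unfolding corrections_def by auto
      \<comment> \<open>Let \<open>t = card (verts q m)\<close>. If the first two cases fail, then
        \<open>P + M < t\<close>, so \<open>z \<ge> d - m - (P + M) > d - m - t \<ge> m\<close> by
        the first assumption.\<close>
      consider "r \<le> P" | "card (verts q m) - 1 - r \<le> M" | "m \<le> z"
        using a(2,3) assms(1) by linarith
      then show ?thesis
      proof cases
        case 1
        then show ?thesis using a(1,4) by simp
      next
        case 2
        then obtain y where y: "y + (card (verts q m) - 1 - r) + 1 = D + card (verts q m)"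
          "sep_out q d y (d - m + 1)"
          using a(5) by blast
        then have "y = s" using a(1,2) by simp
        then show ?thesis using y(2) by simp
      next
        case 3
        then show ?thesis using sep_out_mono[OF a(6)] by simp
      qed
    qed simp
    then show ?thesis unfolding sep_in_def sep_out_def by blast
  qed
  then obtain S B where SB: "separates q d S B" "card S = s" "card B \<le> d - m + 1" by blast
  have "card (vertex_boundary (complete_tree q d) S) \<le> card B"
    using separates_vertex_boundary[OF SB(1)] separates_finite[OF SB(1)] card_mono by blast
  then show ?thesis using SB unfolding separates_def by (intro exI[of _ S]) simp
qed

lemma Phi_V_le:
  assumes "finite (pverts G)"
    and "\<And>s. s \<le> card (pverts G) \<Longrightarrow>
      \<exists>S \<subseteq> pverts G. card S = s \<and> card (vertex_boundary G S) \<le> b"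
  shows "Phi_V G \<le> b"
proof -
  have "Phi_V_at G s \<le> b" if "s \<le> card (pverts G)" for s
  proof -
    obtain S where S: "S \<subseteq> pverts G" "card S = s" "card (vertex_boundary G S) \<le> b"
      using assms(2)[OF \<open>s \<le> card (pverts G)\<close>] by blast
    have "finite {card (vertex_boundary G S) |S. S \<subseteq> pverts G \<and> card S = s}"
      by (rule finite_subset[of _ "(\<lambda>S. card (vertex_boundary G S)) ` Pow (pverts G)"])
        (use assms(1) in auto)
    then have "Phi_V_at G s \<le> card (vertex_boundary G S)"
      unfolding Phi_V_at_def using S by (intro Min_le) auto
    with S show ?thesis by simp
  qed
  \<comment> \<open>The image form shows that \<open>Max\<close> ranges over a finite nonempty
    set.\<close>
  moreover have "{Phi_V_at G s |s. 0 \<le> s \<and> s \<le> card (pverts G)} = Phi_V_at G ` {..card (pverts G)}"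
    by auto
  ultimately show ?thesis
    unfolding Phi_V_def by simp
qed

text \<open>The geometric sum, with \<open>q = Suc p\<close> so that neither division nor
  subtraction occurs.\<close>

lemma card_verts_power: "p * card (verts (Suc p) h) + 1 = Suc p ^ Suc h"
proof (induction h)
  case (Suc h)
  have "p * card (verts (Suc p) (Suc h)) + 1 = Suc p * (p * card (verts (Suc p) h) + 1)"
    by (simp add: card_verts_Suc algebra_simps)
  then show ?case by (simp only: Suc.IH power_Suc)
qed simp

lemma power_3_ge: "4 * m \<le> (3::nat) ^ Suc m"
proof (induction m)
  case (Suc m)
  then show ?case by (cases m) auto
qed simp

theorem theorem3p6:
  fixes q :: nat
  assumes "q \<in> {3, 4}"
  shows "\<exists>d\<^sub>0 :: nat. \<forall>d \<ge> d\<^sub>0.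
    int (Phi_V (complete_tree q d)) \<le> int d - \<lfloor>log (real q) (real d)\<rfloor> + 2 \<and>
    real_of_int (int d - \<lfloor>log (real q) (real d)\<rfloor> + 2) \<le> real d - log (real q) (real d) + 3"
\<comment> \<open>With \<open>d \<ge> 4 \<ge> q\<close> the logarithm is at least \<open>1\<close>,
  so \<open>m\<close> below is not truncated.\<close>
proof (intro exI[of _ 4] allI impI conjI)
  fix d :: nat
  assume d: "4 \<le> d"
  have q: "3 \<le> q" "q \<le> 4" using assms by auto
  \<comment> \<open>This choice gives \<open>q ^ Suc m \<le> d\<close>, and \<open>d - m + 1\<close>
    becomes the claimed bound.\<close>
  define m where "m = nat \<lfloor>log (real q) (real d)\<rfloor> - 1"
  have "1 \<le> log (real q) (real d)"
    using q d by (subst le_log_iff) auto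
  then have m: "\<lfloor>log (real q) (real d)\<rfloor> = int m + 1"
    unfolding m_def by linarith
  then have "real (Suc m) \<le> log (real q) (real d)"
    by linarith
  then have "real q powr real (Suc m) \<le> real d"
    using q d by (subst (asm) le_log_iff) auto
  then have "real (q ^ Suc m) \<le> real d"
    using q by (subst (asm) powr_realpow) auto
  then have pow: "q ^ Suc m \<le> d" by linarith
  have "Suc (q - 1) = q" using q by simp
  then have "(q - 1) * card (verts q m) + 1 = q ^ Suc m"
    using card_verts_power[of "q - 1" m] by metis
  \<comment> \<open>The budget \<open>d\<close> is split in halves:
    \<open>card (verts q m) \<le> d / 2\<close> since \<open>q - 1 \<ge> 2\<close>, and
    \<open>2 * m \<le> d / 2\<close> by \<open>power_3_ge\<close>.\<close>
  moreover have "2 * card (verts q m) \<le> (q - 1) * card (verts q m)"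
    using q by (intro mult_right_mono) auto
  ultimately have "2 * card (verts q m) \<le> d"
    using pow by linarith
  moreover have "4 * m \<le> d"
    using power_3_ge[of m] power_mono[OF q(1), of "Suc m"] pow by linarith
  ultimately have le: "card (verts q m) + 2 * m \<le> d" by linarith
  have "Phi_V (complete_tree q d) \<le> d - m + 1"
    using small_boundary_exists[OF le q] by (intro Phi_V_le finite_verts) blast
  then show "int (Phi_V (complete_tree q d)) \<le> int d - \<lfloor>log (real q) (real d)\<rfloor> + 2"
    using m le by linarith
  show "real_of_int (int d - \<lfloor>log (real q) (real d)\<rfloor> + 2) \<le> real d - log (real q) (real d) + 3"
    by linarith
qed

end
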